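(* Let $V$ be a real vector space and let $U$ be a finite-codimensional subspace of $V$ given as $U = \ker(\eta_1) \cap \cdots \cap \ker(\eta_m)$ for some linear functionals $\eta_1,\ldots,\eta_m \in V^*$. If $\mu_i \in V^*$, $i \in I$, are linear functionals on $V$ and if $\rho$ is a sublinear functional on $V$ such that $$\inf_{i \in I} \mu_i(u) \le \rho(u) \qquad \mbox{for all } u \in U,$$ then there exist scalars $c_1,\ldots,c_m \in \mathbb{R}$ such that $$\inf_{i \in I} \mu_i(v) + \sum_{k=1}^m c_k \eta_k(v) \le \rho(v) \qquad \mbox{for all } v \in V.$$
   Context: $V^*$ denotes the space of linear functionals on $V$ (no topology is involved). A sublinear functional $\rho: V \to \mathbb{R}$ is one that is positively homogeneous and convex. The index set $I$ is arbitrary.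
   Formalization: The infimum of the μ_i(v) is additionally assumed to be greater than −∞ for every v in V; without this the claim fails, e.g. V = ℝ², μ_i(u,t) = u/i − it (i ≥ 1), η(u,t) = t, ρ = 0. *)

theory Defs
  imports "HOL-Analysis.Analysis"
begin

definition positively_homogeneous :: "('v::real_vector \<Rightarrow> real) \<Rightarrow> bool" where
  "positively_homogeneous \<rho> \<longleftrightarrow> (\<forall>t>0. \<forall>x. \<rho> (t *\<^sub>R x) = t * \<rho> x)"

definition sublinear :: "('v::real_vector \<Rightarrow> real) \<Rightarrow> bool" where
  "sublinear \<rho> \<longleftrightarrow> positively_homogeneous \<rho> \<and> convex_on UNIV \<rho>"

(* The infimum is taken in the extended reals, so that it exists for every index set and
   every family. For the empty index set it is PInfty, which exceeds rho at 0.
   That it is never MInfty has to be assumed on the whole space (in the form: the pointwise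
   infimum is a number), not just on the subspace U. On the plane let
   mu_i (u, t) = u / i - i * t for i = 1, 2, 3, ..., let eta (u, t) = t and rho = 0.
   On the kernel of eta the infimum is finite and at most 0, but at (u, -1) with u > 0 it is
   at least 2 * sqrt u, which no fixed multiple of eta (u, -1) = -1 compensates.
   Here the infimum is MInfty at every (u, t) with t > 0. *)
definition inf_functional :: "'i set \<Rightarrow> ('i \<Rightarrow> 'v \<Rightarrow> real) \<Rightarrow> 'v \<Rightarrow> ereal" where
  "inf_functional I \<mu> v = (INF i\<in>I. ereal (\<mu> i v))"

end

theory Submission
  imports Defs
begin

text \<open>
  The pointwise infimum \<open>q\<close> of the \<open>\<mu>\<^sub>i\<close> is nowhere \<open>- \<infinity>\<close> by assumption, and nowhere \<open>\<infinity>\<close>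
  because the bound at the origin forces the index set to be nonempty. Hence \<open>q\<close> is a real-valued
  superadditive and positively homogeneous function, and \<open>\<rho> - q\<close> is sublinear. It is
  nonnegative on \<open>U\<close>, and what is wanted is a linear combination of the \<open>\<eta>\<^sub>k\<close> below it. This is a
  Hahn--Banach extension of the zero functional from \<open>U\<close> to the whole space. As \<open>U\<close> has finite
  codimension, no transfinite argument is involved: one \<open>\<eta>\<^sub>k\<close> is handled at a time
  (\<open>sublinear_dominates_multiple\<close>), and induction on their number finishes the proof
  (\<open>sublinear_dominates_combination\<close>). Since every extension step subtracts a multiple of one
  given \<open>\<eta>\<^sub>k\<close>, the resulting functional is a combination of the \<open>\<eta>\<^sub>k\<close> by construction.
\<close>

lemma sublinear_scaleR: "sublinear f \<Longrightarrow> t > 0 \<Longrightarrow> f (t *\<^sub>R x) = t * f x"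
  by (simp add: sublinear_def positively_homogeneous_def)

text \<open>
  Convexity at the midpoint, rescaled by two.
\<close>
lemma sublinear_add_le:
  assumes "sublinear f"
  shows "f (x + y) \<le> f x + f y"
proof -
  have "f ((1/2) *\<^sub>R (2 *\<^sub>R x) + (1/2) *\<^sub>R (2 *\<^sub>R y)) \<le> 1/2 * f (2 *\<^sub>R x) + 1/2 * f (2 *\<^sub>R y)"
    using assms convex_onD[of UNIV f "1/2" "2 *\<^sub>R x" "2 *\<^sub>R y"] by (simp add: sublinear_def)
  then show ?thesis
    using assms by (simp add: sublinear_scaleR)
qed

lemma sublinearI:
  assumes scale: "\<And>t x. t > 0 \<Longrightarrow> f (t *\<^sub>R x) = t * f x"
    and add: "\<And>x y. f (x + y) \<le> f x + f y"
  shows "sublinear f"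
proof -
  have "convex_on UNIV f"
  proof (rule convex_onI)
    fix t :: real and x y
    assume "0 < t" "t < 1"
    then show "f ((1 - t) *\<^sub>R x + t *\<^sub>R y) \<le> (1 - t) * f x + t * f y"
      using add[of "(1 - t) *\<^sub>R x" "t *\<^sub>R y"] scale[of "1 - t" x] scale[of t y] by simp
  qed simp
  with scale show ?thesis
    by (simp add: sublinear_def positively_homogeneous_def)
qed

lemma sublinear_diff_superlinear:
  assumes "sublinear f"
    and "\<And>t x. t > 0 \<Longrightarrow> q (t *\<^sub>R x) = t * q x"
    and "\<And>x y. q x + q y \<le> q (x + y)"
  shows "sublinear (\<lambda>x. f x - q x)"
proof (rule sublinearI)
  fix x y
  show "f (x + y) - q (x + y) \<le> (f x - q x) + (f y - q y)"
    using sublinear_add_le[OF assms(1), of x y] assms(3)[of x y] by linarith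
qed (simp add: sublinear_scaleR[OF assms(1)] assms(2) right_diff_distrib)

text \<open>
  The one-dimensional extension step. The inequality requires \<open>c \<le> g a / \<eta> a\<close> where \<open>\<eta> a > 0\<close> and
  \<open>c \<ge> g b / \<eta> b\<close> where \<open>\<eta> b < 0\<close>. Each lower bound is at most each upper bound, because the
  positive combination \<open>- \<eta> b *\<^sub>R a + \<eta> a *\<^sub>R b\<close> lies in the kernel of \<open>\<eta>\<close>, where \<open>g\<close> is
  nonnegative. The supremum of the lower bounds is then a possible \<open>c\<close>.
\<close>
lemma sublinear_dominates_multiple:
  fixes g \<eta> :: "'v::real_vector \<Rightarrow> real"
  assumes g: "sublinear g" and \<eta>: "linear \<eta>" and W: "subspace W"
    and nonneg: "\<And>v. v \<in> W \<Longrightarrow> \<eta> v = 0 \<Longrightarrow> 0 \<le> g v"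
  shows "\<exists>c. \<forall>v\<in>W. c * \<eta> v \<le> g v"
proof (cases "\<exists>a\<in>W. \<eta> a > 0")
  case True
  define B where "B = {b \<in> W. \<eta> b < 0}"
  define c where "c = (SUP b\<in>B. g b / \<eta> b)"
  have bounds: "g b / \<eta> b \<le> g a / \<eta> a" if "a \<in> W" "\<eta> a > 0" "b \<in> B" for a b
  proof -
    have b: "b \<in> W" "\<eta> b < 0"
      using that by (auto simp: B_def)
    have "0 \<le> g ((- \<eta> b) *\<^sub>R a + \<eta> a *\<^sub>R b)"
      using that(1) b(1) W
      by (intro nonneg subspace_add subspace_mul)
         (simp_all add: linear_add[OF \<eta>] linear_diff[OF \<eta>] linear_neg[OF \<eta>] linear_scale[OF \<eta>])
    also have "\<dots> \<le> (- \<eta> b) * g a + \<eta> a * g b"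
      using sublinear_add_le[OF g, of "(- \<eta> b) *\<^sub>R a" "\<eta> a *\<^sub>R b"]
        sublinear_scaleR[OF g, of "- \<eta> b" a] sublinear_scaleR[OF g, of "\<eta> a" b] that(2) b(2)
      by simp
    finally show ?thesis
      using that(2) b(2) by (simp add: field_simps)
  qed
  obtain a0 where a0: "a0 \<in> W" "\<eta> a0 > 0"
    using True by blast
  have "- a0 \<in> B"
    using a0 W by (simp add: B_def subspace_neg linear_neg[OF \<eta>])
  then have "B \<noteq> {}"
    by blast
  have "c * \<eta> v \<le> g v" if "v \<in> W" for v
  proof (cases "\<eta> v" "0 :: real" rule: linorder_cases)
    case less
    have "bdd_above ((\<lambda>b. g b / \<eta> b) ` B)"
      using bounds[OF a0] by (intro bdd_aboveI2)
    then have "g v / \<eta> v \<le> c"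
      unfolding c_def using less that by (intro cSUP_upper) (auto simp: B_def)
    then show ?thesis
      using less by (simp add: field_simps)
  next
    case equal
    then show ?thesis
      using nonneg[OF that] by simp
  next
    case greater
    have "c \<le> g v / \<eta> v"
      unfolding c_def using \<open>B \<noteq> {}\<close> bounds[OF that greater] by (intro cSUP_least)
    then show ?thesis
      using greater by (simp add: field_simps)
  qed
  then show ?thesis
    by blast
next
  (* A subspace is symmetric, so a linear functional that is never positive on it vanishes on it. *)
  case False
  have "\<eta> v = 0" if "v \<in> W" for v
    using False that subspace_neg[OF W that] linear_neg[OF \<eta>, of v]
    by (metis linorder_neqE_linordered_idom neg_0_less_iff_less)
  then have "\<forall>v\<in>W. 0 * \<eta> v \<le> g v"
    using nonneg by simp
  then show ?thesis
    by blast
qed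

text \<open>
  The subspace \<open>W\<close> is there for the induction on \<open>m\<close>: the induction hypothesis, applied to the
  kernel of the last functional in \<open>W\<close>, yields a combination that is dominated on that kernel
  only. Subtracting it leaves a sublinear function to which the one-dimensional step applies.
\<close>
lemma sublinear_dominates_combination:
  fixes f :: "'v::real_vector \<Rightarrow> real" and \<eta> :: "nat \<Rightarrow> 'v \<Rightarrow> real"
  assumes f: "sublinear f"
    and "\<And>k. k \<in> {1..m} \<Longrightarrow> linear (\<eta> k)"
    and "subspace W"
    and "\<And>v. v \<in> W \<Longrightarrow> \<forall>k\<in>{1..m}. \<eta> k v = 0 \<Longrightarrow> 0 \<le> f v"
  shows "\<exists>c. \<forall>v\<in>W. (\<Sum>k=1..m. c k * \<eta> k v) \<le> f v"
  using assms(2-)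
proof (induction m arbitrary: W)
  case 0
  then show ?case
    by simp
next
  case (Suc m)
  let ?K = "W \<inter> {v. \<eta> (Suc m) v = 0}"
  have lin: "linear (\<eta> k)" if "k \<in> {1..Suc m}" for k
    using Suc.prems(1) that .
  have "subspace ?K"
    using Suc.prems(2) lin by (simp add: subspace_inter linear_subspace_kernel)
  moreover have "0 \<le> f v" if "v \<in> ?K" "\<forall>k\<in>{1..m}. \<eta> k v = 0" for v
    using that by (intro Suc.prems(3)) (auto simp: le_Suc_eq)
  ultimately obtain c where c: "\<forall>v\<in>?K. (\<Sum>k=1..m. c k * \<eta> k v) \<le> f v"
    using Suc.IH[of ?K] lin by fastforce
  let ?g = "\<lambda>v. f v - (\<Sum>k=1..m. c k * \<eta> k v)"
  have "sublinear ?g"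
  proof (rule sublinear_diff_superlinear[OF f])
    fix t :: real and x
    show "(\<Sum>k=1..m. c k * \<eta> k (t *\<^sub>R x)) = t * (\<Sum>k=1..m. c k * \<eta> k x)"
      unfolding sum_distrib_left by (rule sum.cong) (simp_all add: linear_scale[OF lin])
  next
    fix x y
    have "(\<Sum>k=1..m. c k * \<eta> k (x + y)) = (\<Sum>k=1..m. c k * \<eta> k x + c k * \<eta> k y)"
      by (rule sum.cong) (simp_all add: linear_add[OF lin] distrib_left)
    then show "(\<Sum>k=1..m. c k * \<eta> k x) + (\<Sum>k=1..m. c k * \<eta> k y) \<le> (\<Sum>k=1..m. c k * \<eta> k (x + y))"
      by (simp add: sum.distrib)
  qed
  then obtain d where d: "\<forall>v\<in>W. d * \<eta> (Suc m) v \<le> ?g v"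
    using sublinear_dominates_multiple[of ?g "\<eta> (Suc m)" W] lin Suc.prems(2) c by auto
  have "(\<Sum>k=1..Suc m. (c(Suc m := d)) k * \<eta> k v) \<le> f v" if "v \<in> W" for v
  proof -
    have "(\<Sum>k=1..m. (c(Suc m := d)) k * \<eta> k v) = (\<Sum>k=1..m. c k * \<eta> k v)"
      by (rule sum.cong) auto
    then show ?thesis
      using d that by (simp add: algebra_simps)
  qed
  then show ?case
    by blast
qed

theorem lemma2:
  fixes \<eta> :: "nat \<Rightarrow> 'v::real_vector \<Rightarrow> real"
    and m :: nat
    and U :: "'v set"
    and \<mu> :: "'i \<Rightarrow> 'v \<Rightarrow> real"
    and I :: "'i set"
    and \<rho> :: "'v \<Rightarrow> real"
  assumes "\<And>k. k \<in> {1..m} \<Longrightarrow> linear (\<eta> k)"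
    and "U = (\<Inter>k\<in>{1..m}. {x. \<eta> k x = 0})"
    and "\<And>i. i \<in> I \<Longrightarrow> linear (\<mu> i)"
    and "\<forall>v. inf_functional I \<mu> v \<noteq> - \<infinity>"
    and "sublinear \<rho>"
    and "\<forall>u\<in>U. inf_functional I \<mu> u \<le> ereal (\<rho> u)"
  shows "\<exists>c :: nat \<Rightarrow> real. \<forall>v.
    inf_functional I \<mu> v + ereal (\<Sum>k=1..m. c k * \<eta> k v) \<le> ereal (\<rho> v)"
proof -
  (* The infimum over the empty set is infinite, which the bound at the origin excludes. *)
  have "0 \<in> U"
    using assms(1) by (auto simp: assms(2) linear_0)
  then have "I \<noteq> {}"
    using assms(6) by (force simp: inf_functional_def top_ereal_def)
  define q where "q v = real_of_ereal (inf_functional I \<mu> v)" for v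
  have q: "inf_functional I \<mu> v = ereal (q v)" for v
  proof -
    obtain i where "i \<in> I"
      using \<open>I \<noteq> {}\<close> by blast
    then have "inf_functional I \<mu> v \<le> ereal (\<mu> i v)"
      unfolding inf_functional_def by (rule INF_lower)
    then have "inf_functional I \<mu> v \<noteq> \<infinity>"
      by auto
    then show ?thesis
      using assms(4) by (cases "inf_functional I \<mu> v") (auto simp: q_def)
  qed
  have q_lower: "q v \<le> \<mu> i v" if "i \<in> I" for i v
    using INF_lower[OF that, of "\<lambda>i. ereal (\<mu> i v)"] q[of v] by (simp add: inf_functional_def)
  have q_greatest: "r \<le> q v" if "\<And>i. i \<in> I \<Longrightarrow> r \<le> \<mu> i v" for r v
    using INF_greatest[of I "ereal r" "\<lambda>i. ereal (\<mu> i v)"] q[of v] that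
    by (simp add: inf_functional_def)
  have q_scale_le: "t * q x \<le> q (t *\<^sub>R x)" if "t > 0" for t x
    using that q_lower by (intro q_greatest) (simp add: linear_scale[OF assms(3)])
  have "sublinear (\<lambda>v. \<rho> v - q v)"
  proof (rule sublinear_diff_superlinear[OF assms(5)])
    fix t :: real and x
    assume t: "t > 0"
    (* The reverse inequality is the same one for the inverse scaling. *)
    have "inverse t * q (t *\<^sub>R x) \<le> q x"
      using q_scale_le[of "inverse t" "t *\<^sub>R x"] t by simp
    then have "q (t *\<^sub>R x) \<le> t * q x"
      using t by (simp add: field_simps)
    then show "q (t *\<^sub>R x) = t * q x"
      using q_scale_le[OF t, of x] by linarith
  next
    fix x y
    show "q x + q y \<le> q (x + y)"
      using q_lower by (intro q_greatest) (simp add: linear_add[OF assms(3)] add_mono)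
  qed
  moreover have "0 \<le> \<rho> v - q v" if "\<forall>k\<in>{1..m}. \<eta> k v = 0" for v
    using assms(6) that by (auto simp: assms(2) q)
  ultimately obtain c where "\<forall>v\<in>UNIV. (\<Sum>k=1..m. c k * \<eta> k v) \<le> \<rho> v - q v"
    using sublinear_dominates_combination[of "\<lambda>v. \<rho> v - q v" m \<eta> UNIV] assms(1) by auto
  then have "\<forall>v. inf_functional I \<mu> v + ereal (\<Sum>k=1..m. c k * \<eta> k v) \<le> ereal (\<rho> v)"
    by (simp add: q algebra_simps)
  then show ?thesis
    by blast
qed

end
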